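(* Let $G=(V,E)$ be a finite simple graph and let $f:V\to\mathbb{R}$ be a Morse function on $G$ with index function $i_f(v)=1-\chi(S^-(v))$, $v\in V$. Then $$\sum_{v\in V} i_f(v)=\chi(G).$$
   Context: For a finite simple graph $H$, the Euler characteristic is $\chi(H)=\sum_{n=0}^{\infty}(-1)^n v_n(H)$, where $v_n(H)$ is the number of subgraphs of $H$ that are complete graphs $K_{n+1}$ on $n+1$ vertices (so $v_0$ is the number of vertices, $v_1$ the number of edges, $v_2$ the number of triangles, etc.). The Euler characteristic of the empty graph is $0$. For a vertex $v$ of $G=(V,E)$, the unit sphere $S(v)$ is the subgraph of $G$ induced (generated) by the vertex set $\{w\in V : (v,w)\in E\}$ of neighbors of $v$. The unit ball is $B(v)=\{v\}\cup S(v)$. A function $f:V\to\mathbb{R}$ is called a Morse function on $G$ if, for every vertex $v$, $f$ is injective on the vertex set of $B(v)$. Given a Morse function $f$, $S^-(v)$ denotes the subgraph of $S(v)$ induced by the vertices $\{w\in S(v) : f(w)-f(v)<0\}$. The index of $f$ at $v$ is $i_f(v)=1-\chi(S^-(v))$. *)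

theory Defs
  imports Complex_Main "Graph_Theory.Graph_Theory"
begin

text \<open>
  A finite simple graph is a digraph satisfying the locale predicate \<open>graph\<close> (finite, loop-free, no
  parallel arcs, symmetric), so that an undirected edge is a pair of opposite arcs.  The library
  predicate \<open>K\<^bsub>n\<^esub>\<close> includes \<open>graph\<close>; hence a complete subgraph contains both arcs of each of its
  edges, and every undirected edge is counted exactly once as a subgraph \<open>K\<^bsub>2\<^esub>\<close>.
\<close>

definition complete_count :: "('a, 'b) pre_digraph \<Rightarrow> nat \<Rightarrow> nat" where
  "complete_count H n = card {C. subgraph C H \<and> K\<^bsub>n + 1\<^esub> C}"

text \<open>The series has only finitely many nonzero terms if \<open>H\<close> is finite (see below).\<close>

definition euler_char :: "('a, 'b) pre_digraph \<Rightarrow> int" where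
  "euler_char H = (\<Sum>n. (- 1) ^ n * int (complete_count H n))"

definition unit_sphere :: "('a, 'b) pre_digraph \<Rightarrow> 'a \<Rightarrow> ('a, 'b) pre_digraph" where
  "unit_sphere G v = G \<restriction> {w \<in> verts G. v \<rightarrow>\<^bsub>G\<^esub> w}"

definition unit_ball :: "('a, 'b) pre_digraph \<Rightarrow> 'a \<Rightarrow> ('a, 'b) pre_digraph" where
  "unit_ball G v = G \<restriction> ({v} \<union> verts (unit_sphere G v))"

definition morse_function :: "('a, 'b) pre_digraph \<Rightarrow> ('a \<Rightarrow> real) \<Rightarrow> bool" where
  "morse_function G f \<longleftrightarrow> (\<forall>v \<in> verts G. inj_on f (verts (unit_ball G v)))"

definition lower_sphere :: "('a, 'b) pre_digraph \<Rightarrow> ('a \<Rightarrow> real) \<Rightarrow> 'a \<Rightarrow> ('a, 'b) pre_digraph" where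
  "lower_sphere G f v =
     unit_sphere G v \<restriction> {w \<in> verts (unit_sphere G v). f w - f v < 0}"

definition morse_index :: "('a, 'b) pre_digraph \<Rightarrow> ('a \<Rightarrow> real) \<Rightarrow> 'a \<Rightarrow> int" where
  "morse_index G f v = 1 - euler_char (lower_sphere G f v)"

lemma complete_count_eq_0:
  assumes "finite (verts H)" "n \<ge> card (verts H)"
  shows "complete_count H n = 0"
proof -
  have False if "subgraph C H" "K\<^bsub>n + 1\<^esub> C" for C :: "('a, 'b) pre_digraph"
  proof -
    have "card (verts C) \<le> card (verts H)"
      using that assms(1) by (intro card_mono) (auto simp: subgraph_def)
    then show False using that assms(2) by (auto simp: complete_digraph_def)
  qed
  then have "{C. subgraph C H \<and> K\<^bsub>n + 1\<^esub> C} = {}" by blast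
  then show ?thesis unfolding complete_count_def by (simp only: card.empty)
qed

lemma euler_char_finite_sum:
  assumes "finite (verts H)"
  shows "euler_char H = (\<Sum>n<card (verts H). (- 1) ^ n * int (complete_count H n))"
  unfolding euler_char_def
  by (rule suminf_finite) (auto simp: complete_count_eq_0 assms)

lemma finite_complete_subgraphs:
  assumes "fin_digraph H"
  shows "finite {C. subgraph C H \<and> K\<^bsub>n\<^esub> C}"
proof -
  interpret fin_digraph H by (fact assms)
  have "{C. subgraph C H \<and> K\<^bsub>n\<^esub> C} \<subseteq>
    (\<lambda>(V, A). \<lparr>verts = V, arcs = A, tail = tail H, head = head H\<rparr>) ` (Pow (verts H) \<times> Pow (arcs H))"
  proof
    fix C :: "('a, 'b) pre_digraph"
    assume C: "C \<in> {C. subgraph C H \<and> K\<^bsub>n\<^esub> C}"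
    then have "C = \<lparr>verts = verts C, arcs = arcs C, tail = tail H, head = head H\<rparr>"
      by (cases C) (auto simp: subgraph_def compatible_def)
    moreover have "(verts C, arcs C) \<in> Pow (verts H) \<times> Pow (arcs H)"
      using C by (auto simp: subgraph_def)
    ultimately show "C \<in> (\<lambda>(V, A). \<lparr>verts = V, arcs = A, tail = tail H, head = head H\<rparr>) `
        (Pow (verts H) \<times> Pow (arcs H))"
      by (metis (mono_tags, lifting) case_prod_conv image_eqI)
  qed
  then show ?thesis
    by (rule finite_subset) simp
qed

text \<open>For simple graphs, complete subgraphs correspond to cliques, i.e. to their vertex sets.\<close>

lemma complete_count_eq_cliques:
  assumes "graph G"
  shows "complete_count G n =
    card {S. S \<subseteq> verts G \<and> card S = n + 1 \<and> (\<forall>u \<in> S. \<forall>v \<in> S. u \<noteq> v \<longrightarrow> u \<rightarrow>\<^bsub>G\<^esub> v)}"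
    (is "_ = card ?Cl")
proof -
  interpret graph G by (fact assms)
  have *: "C = G \<restriction> verts C" if C: "subgraph C G" "K\<^bsub>n + 1\<^esub> C" for C
  proof -
    have "e \<in> arcs C" if e: "e \<in> arcs G" "tail G e \<in> verts C" "head G e \<in> verts C" for e
    proof -
      have "(tail G e, head G e) \<in> arcs_ends C"
        using C(2) e no_loops[OF e(1)] by (auto simp: complete_digraph_def)
      then obtain e' where e': "e' \<in> arcs C" "arc_to_ends C e' = (tail G e, head G e)"
        by (auto simp: arcs_ends_def)
      then have "e' \<in> arcs G" "arc_to_ends G e' = arc_to_ends G e"
        using C(1) by (auto simp: subgraph_def compatible_def arc_to_ends_def)
      then show ?thesis using no_multi_arcs e(1) e'(1) by metis
    qed
    moreover have "arcs C \<subseteq> {e \<in> arcs G. tail G e \<in> verts C \<and> head G e \<in> verts C}"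
      using C(1) by (auto simp: subgraph_def compatible_def wf_digraph_def)
    ultimately have "arcs C = {e \<in> arcs G. tail G e \<in> verts C \<and> head G e \<in> verts C}" by blast
    then show ?thesis
      using C(1) by (cases C) (simp add: subgraph_def compatible_def induce_subgraph_def)
  qed
  have K: "K\<^bsub>n + 1\<^esub> (G \<restriction> S)" "subgraph (G \<restriction> S) G" if S: "S \<in> ?Cl" for S
  proof -
    have ind: "induced_subgraph (G \<restriction> S) G" using S by (intro induced_induce) auto
    then show "subgraph (G \<restriction> S) G" by (simp add: induced_subgraph_def)
    have "graph (G \<restriction> S)" using digraphI_induced[OF ind] induced_graph_imp_symmetric[OF sym_arcs ind]
      by (rule digraph.graphI)
    moreover have "arcs_ends (G \<restriction> S) = {(u, v). (u, v) \<in> S \<times> S \<and> u \<noteq> v}"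
    proof (intro equalityI subsetI)
      fix p assume "p \<in> arcs_ends (G \<restriction> S)"
      then show "p \<in> {(u, v). (u, v) \<in> S \<times> S \<and> u \<noteq> v}"
        using no_loops by (auto simp: arcs_ends_def arc_to_ends_def)
    next
      fix p assume "p \<in> {(u, v). (u, v) \<in> S \<times> S \<and> u \<noteq> v}"
      then obtain u v where p: "p = (u, v)" "u \<in> S" "v \<in> S" "u \<noteq> v" by auto
      then have "(u, v) \<in> arcs_ends G" using S by auto
      then obtain e where "e \<in> arcs G" "tail G e = u" "head G e = v"
        by (auto simp: arcs_ends_def arc_to_ends_def)
      then show "p \<in> arcs_ends (G \<restriction> S)" using p
        by (auto simp: arcs_ends_def arc_to_ends_def intro!: image_eqI[of _ _ e])
    qed
    ultimately show "K\<^bsub>n + 1\<^esub> (G \<restriction> S)" using S by (simp add: complete_digraph_def)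
  qed
  have "bij_betw verts {C. subgraph C G \<and> K\<^bsub>n + 1\<^esub> C} ?Cl"
  proof (rule bij_betw_byWitness[where f' = "\<lambda>S. G \<restriction> S"])
    show "\<forall>C\<in>{C. subgraph C G \<and> K\<^bsub>n + 1\<^esub> C}. G \<restriction> verts C = C" using * by auto
    show "\<forall>S\<in>?Cl. verts (G \<restriction> S) = S" by simp
    show "(\<lambda>S. G \<restriction> S) ` ?Cl \<subseteq> {C. subgraph C G \<and> K\<^bsub>n + 1\<^esub> C}" using K by blast
    show "verts ` {C. subgraph C G \<and> K\<^bsub>n + 1\<^esub> C} \<subseteq> ?Cl"
    proof clarify
      fix C assume C: "subgraph C G" "K\<^bsub>n + 1\<^esub> C"
      have "arcs_ends C \<subseteq> arcs_ends G"
        using C(1) by (auto simp: subgraph_def compatible_def arcs_ends_def arc_to_ends_def)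
      then show "verts C \<subseteq> verts G \<and> card (verts C) = n + 1 \<and>
          (\<forall>u \<in> verts C. \<forall>v \<in> verts C. u \<noteq> v \<longrightarrow> u \<rightarrow>\<^bsub>G\<^esub> v)"
        using C by (auto simp: subgraph_def complete_digraph_def)
    qed
  qed
  then show ?thesis unfolding complete_count_def by (rule bij_betw_same_card)
qed

end

theory Submission
  imports Defs
begin

text \<open>
  In a finite simple graph \<open>H\<close>, \<open>1 - \<chi>(H)\<close> is the sum of \<open>(-1)\<^bsup>|S|\<^esup>\<close> over all cliques \<open>S\<close> of \<open>H\<close>, the empty
  one included (\<open>one_minus_euler_char\<close>): the empty clique supplies the summand 1.  Thus \<open>\<chi>(G)\<close> is
  minus this sum over the nonempty cliques of \<open>G\<close>, while the index at \<open>v\<close> is the full sum over the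
  cliques of \<open>S\<^sup>-(v)\<close>.

  Sort the nonempty cliques of \<open>G\<close> by their vertex of largest \<open>f\<close>-value.  That vertex is
  unique, because a clique lies in the unit ball of each of its vertices and \<open>f\<close> is injective there
  (\<open>clique_has_peak\<close>).  Removing the largest vertex \<open>v\<close> leaves an arbitrary, possibly empty,
  clique of \<open>S\<^sup>-(v)\<close> and reverses the sign (\<open>morse_index_peaked_cliques\<close>), so the cliques with largest vertex
  \<open>v\<close> contribute exactly the index at \<open>v\<close>.
\<close>

definition cliques :: "('a, 'b) pre_digraph \<Rightarrow> 'a set set" where
  "cliques G = {S. S \<subseteq> verts G \<and> (\<forall>u \<in> S. \<forall>v \<in> S. u \<noteq> v \<longrightarrow> u \<rightarrow>\<^bsub>G\<^esub> v)}"

definition peaked_cliques :: "('a, 'b) pre_digraph \<Rightarrow> ('a \<Rightarrow> real) \<Rightarrow> 'a \<Rightarrow> 'a set set" where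
  "peaked_cliques G f v = {S \<in> cliques G. v \<in> S \<and> (\<forall>w \<in> S - {v}. f w < f v)}"

lemma finite_cliques:
  assumes "finite (verts G)"
  shows "finite (cliques G)"
  by (rule finite_subset[of _ "Pow (verts G)"]) (use assms in \<open>auto simp: cliques_def\<close>)

lemma finite_clique:
  assumes "finite (verts G)" "S \<in> cliques G"
  shows "finite S"
  using assms by (auto simp: cliques_def intro: finite_subset)

lemma euler_char_nonempty_cliques:
  assumes "graph G"
  shows "euler_char G = - (\<Sum>S \<in> cliques G - {{}}. (- 1) ^ card S)"
proof -
  interpret graph G by (fact assms)
  let ?C = "cliques G - {{}}"
  have card_S: "0 < card S" "card S \<le> card (verts G)" if "S \<in> ?C" for S
    using that finite_clique[OF finite_verts] by (auto simp: card_gt_0_iff cliques_def card_mono)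
  have "euler_char G = (\<Sum>n<card (verts G). (- 1) ^ n * int (complete_count G n))"
    by (rule euler_char_finite_sum) simp
  also have "\<dots> = (\<Sum>n<card (verts G). \<Sum>S \<in> {S \<in> ?C. card S - 1 = n}. - ((- 1) ^ card S))"
  proof (rule sum.cong[OF refl])
    fix n
    have "{S \<in> ?C. card S - 1 = n} = {S \<in> cliques G. card S = n + 1}"
      using card_S(1) by fastforce
    also have "\<dots> = {S. S \<subseteq> verts G \<and> card S = n + 1 \<and>
        (\<forall>u \<in> S. \<forall>v \<in> S. u \<noteq> v \<longrightarrow> u \<rightarrow>\<^bsub>G\<^esub> v)}"
      by (auto simp: cliques_def)
    finally have count: "complete_count G n = card {S \<in> ?C. card S - 1 = n}"
      by (simp only: complete_count_eq_cliques[OF assms])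
    have "(\<Sum>S \<in> {S \<in> ?C. card S - 1 = n}. - ((- 1) ^ card S)) =
        (\<Sum>S \<in> {S \<in> ?C. card S - 1 = n}. (- 1) ^ n :: int)"
    proof (rule sum.cong[OF refl])
      fix S assume "S \<in> {S \<in> ?C. card S - 1 = n}"
      then have "card S = Suc n" using card_S(1)[of S] by auto
      then show "- ((- 1) ^ card S) = ((- 1) ^ n :: int)" by simp
    qed
    then show "(- 1) ^ n * int (complete_count G n) =
        (\<Sum>S \<in> {S \<in> ?C. card S - 1 = n}. - ((- 1) ^ card S))"
      by (simp add: count)
  qed
  also have "\<dots> = (\<Sum>S \<in> ?C. - ((- 1) ^ card S))"
  proof (rule sum.group)
    show "(\<lambda>S. card S - 1) ` ?C \<subseteq> {..<card (verts G)}"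
      using card_S by fastforce
  qed (simp_all add: finite_cliques)
  finally show ?thesis by (simp add: sum_negf)
qed

lemma one_minus_euler_char:
  assumes "graph G"
  shows "1 - euler_char G = (\<Sum>S \<in> cliques G. (- 1) ^ card S)"
proof -
  interpret graph G by (fact assms)
  have "{} \<in> cliques G" by (simp add: cliques_def)
  then show ?thesis
    using sum.remove[OF finite_cliques[OF finite_verts], of "{}" "\<lambda>S. (- 1 :: int) ^ card S"]
    by (simp add: euler_char_nonempty_cliques[OF assms])
qed

lemma (in graph) graph_induce_subgraph:
  assumes "S \<subseteq> verts G"
  shows "graph (G \<restriction> S)"
proof -
  have ind: "induced_subgraph (G \<restriction> S) G" using assms by (rule induced_induce)
  show ?thesis
    using digraphI_induced[OF ind] induced_graph_imp_symmetric[OF sym_arcs ind]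
    by (rule digraph.graphI)
qed

lemma dominates_induce_subgraph_iff:
  "u \<rightarrow>\<^bsub>G \<restriction> S\<^esub> v \<longleftrightarrow> u \<in> S \<and> v \<in> S \<and> u \<rightarrow>\<^bsub>G\<^esub> v"
  by (auto simp: arcs_ends_def arc_to_ends_def)

lemma verts_lower_sphere:
  "verts (lower_sphere G f v) = {w \<in> verts G. v \<rightarrow>\<^bsub>G\<^esub> w \<and> f w < f v}"
  by (auto simp: lower_sphere_def unit_sphere_def)

lemma graph_lower_sphere:
  assumes "graph G"
  shows "graph (lower_sphere G f v)"
  unfolding lower_sphere_def unit_sphere_def
  by (intro graph.graph_induce_subgraph assms) auto

lemma cliques_lower_sphere:
  "cliques (lower_sphere G f v) = {T \<in> cliques G. \<forall>w \<in> T. v \<rightarrow>\<^bsub>G\<^esub> w \<and> f w < f v}"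
proof -
  have dom: "u \<rightarrow>\<^bsub>lower_sphere G f v\<^esub> w \<longleftrightarrow>
      u \<in> verts (lower_sphere G f v) \<and> w \<in> verts (lower_sphere G f v) \<and> u \<rightarrow>\<^bsub>G\<^esub> w" for u w
    unfolding lower_sphere_def unit_sphere_def
    by (auto simp only: dominates_induce_subgraph_iff induce_subgraph_verts)
  have "T \<in> cliques (lower_sphere G f v) \<longleftrightarrow> T \<subseteq> verts (lower_sphere G f v) \<and> T \<in> cliques G" for T
  proof (cases "T \<subseteq> verts (lower_sphere G f v)")
    case True
    then have "T \<subseteq> verts G" by (auto simp: verts_lower_sphere)
    moreover have "u \<rightarrow>\<^bsub>lower_sphere G f v\<^esub> w \<longleftrightarrow> u \<rightarrow>\<^bsub>G\<^esub> w" if "u \<in> T" "w \<in> T" for u w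
      using that True dom by blast
    ultimately show ?thesis using True by (simp add: cliques_def)
  next
    case False
    then show ?thesis by (simp add: cliques_def)
  qed
  then show ?thesis
    by (auto simp: verts_lower_sphere cliques_def)
qed

text \<open>
  The index counts, up to sign, the cliques that are completed when \<open>v\<close> enters in order of
  increasing \<open>f\<close>.  The map \<open>T \<mapsto> T \<union> {v}\<close> onto these cliques changes the parity of the cardinality,
  which accounts for the minus sign.
\<close>

lemma morse_index_peaked_cliques:
  assumes "graph G" "v \<in> verts G"
  shows "morse_index G f v = - (\<Sum>S \<in> peaked_cliques G f v. (- 1) ^ card S)"
proof -
  interpret graph G by (fact assms)
  let ?L = "cliques (lower_sphere G f v)"
  have notin: "v \<notin> T" if "T \<in> ?L" for T
    using that by (auto simp: cliques_lower_sphere)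
  have fin: "finite T" if "T \<in> ?L" for T
    using that finite_clique[OF finite_verts] by (auto simp: cliques_lower_sphere)
  have "bij_betw (insert v) ?L (peaked_cliques G f v)"
  proof (rule bij_betw_byWitness[where f' = "\<lambda>S. S - {v}"])
    show "\<forall>T \<in> ?L. insert v T - {v} = T" using notin by auto
    show "\<forall>S \<in> peaked_cliques G f v. insert v (S - {v}) = S"
      by (auto simp: peaked_cliques_def)
    show "insert v ` ?L \<subseteq> peaked_cliques G f v"
      unfolding cliques_lower_sphere unfolding peaked_cliques_def cliques_def
      using assms(2) by (auto dest: graph_symmetric)
    show "(\<lambda>S. S - {v}) ` peaked_cliques G f v \<subseteq> ?L"
    proof
      fix T assume "T \<in> (\<lambda>S. S - {v}) ` peaked_cliques G f v"
      then obtain S where "T = S - {v}" "S \<in> cliques G" "v \<in> S" "\<forall>w \<in> S - {v}. f w < f v"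
        by (auto simp: peaked_cliques_def)
      then show "T \<in> ?L"
        unfolding cliques_lower_sphere unfolding cliques_def by auto
    qed
  qed
  then have "(\<Sum>S \<in> peaked_cliques G f v. (- 1 :: int) ^ card S) =
      (\<Sum>T \<in> ?L. (- 1) ^ card (insert v T))"
    by (rule sum.reindex_bij_betw[symmetric])
  also have "\<dots> = (\<Sum>T \<in> ?L. - ((- 1) ^ card T))"
    by (rule sum.cong) (simp_all add: notin fin)
  finally show ?thesis
    by (simp add: sum_negf morse_index_def one_minus_euler_char graph_lower_sphere assms(1))
qed

text \<open>
  A maximum of \<open>f\<close> on a clique is strict: the other vertices are neighbours of the
  maximizing vertex, and \<open>f\<close> is injective on its unit ball.
\<close>

lemma clique_has_peak:
  assumes "finite (verts G)" "morse_function G f" "S \<in> cliques G" "S \<noteq> {}"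
  shows "\<exists>v \<in> verts G. S \<in> peaked_cliques G f v"
proof -
  have "finite S" using assms(1,3) by (rule finite_clique)
  then have "Max (f ` S) \<in> f ` S" using assms(4) by simp
  then obtain v where v: "v \<in> S" "f v = Max (f ` S)" by auto
  have "v \<in> verts G" using v(1) assms(3) by (auto simp: cliques_def)
  then have inj: "inj_on f (verts (unit_ball G v))"
    using assms(2) by (simp add: morse_function_def)
  have "S \<subseteq> verts (unit_ball G v)"
    using v(1) assms(3) by (auto simp: unit_ball_def unit_sphere_def cliques_def)
  then have "f w < f v" if "w \<in> S - {v}" for w
    using that v \<open>finite S\<close> inj by (metis DiffE Max_ge finite_imageI imageI inj_onD
        insertI1 order_le_less subsetD)
  then show ?thesis
    using v(1) assms(3) \<open>v \<in> verts G\<close> by (auto simp: peaked_cliques_def)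
qed

lemma disjoint_peaked_cliques:
  assumes "u \<noteq> v"
  shows "peaked_cliques G f u \<inter> peaked_cliques G f v = {}"
proof -
  have "f u < f v" "f v < f u" if "S \<in> peaked_cliques G f u" "S \<in> peaked_cliques G f v" for S
    using that assms by (auto simp: peaked_cliques_def)
  then show ?thesis by fastforce
qed

theorem theorem1:
  fixes G :: "('a, 'b) pre_digraph" and f :: "'a \<Rightarrow> real"
  assumes "graph G" and "morse_function G f"
  shows "(\<Sum>v\<in>verts G. morse_index G f v) = euler_char G"
proof -
  interpret graph G by (fact assms(1))
  have fin: "finite (peaked_cliques G f v)" for v
    using finite_cliques[OF finite_verts] by (simp add: peaked_cliques_def)
  have "cliques G - {{}} = (\<Union>v \<in> verts G. peaked_cliques G f v)"
    using clique_has_peak[OF finite_verts assms(2)] by (auto simp: peaked_cliques_def)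
  then have "euler_char G = - (\<Sum>S \<in> (\<Union>v \<in> verts G. peaked_cliques G f v). (- 1) ^ card S)"
    by (simp only: euler_char_nonempty_cliques[OF assms(1)])
  also have "\<dots> = - (\<Sum>v \<in> verts G. \<Sum>S \<in> peaked_cliques G f v. (- 1) ^ card S)"
    by (subst sum.UNION_disjoint) (simp_all add: fin disjoint_peaked_cliques)
  also have "\<dots> = (\<Sum>v \<in> verts G. morse_index G f v)"
    by (simp add: morse_index_peaked_cliques[OF assms(1)] sum_negf)
  finally show ?thesis by simp
qed

end
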